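(* Let $A\in\mathcal{F}^{m\times n}$ and $b\in\mathcal{F}^m$ be such that the system $Ax=b$ is consistent (i.e. has at least one solution in $\mathcal{F}^n$). Let $M\in\mathcal{F}^{m\times m}$ be a nonsingular matrix such that the rows of $A'=MA$ form a quasi-orthonormal list of vectors, and put $b'=Mb$. Then $x_p=(A')^*b'$ is a minimum norm solution of $Ax=b$: it satisfies $Ax_p=b$, and $\|x_p\|\le\|x\|$ for every $x\in\mathcal{F}^n$ with $Ax=b$.
   Context: $\mathcal{F}$ is a subfield of $\mathbb{C}$ closed under complex conjugation (for instance $\mathcal{F}=\mathbb{C}$), and $\mathcal{F}^k$ carries the standard inner product $\langle u,v\rangle=\sum_j u_j\overline{v_j}$ and the Euclidean norm $\|u\|=\sqrt{\langle u,u\rangle}$. The superscript $*$ denotes conjugate transpose. A list of vectors is quasi-orthonormal if each vector has norm $1$ or $0$ and the vectors of norm $1$ are mutually orthogonal. The row orthonormalization procedure (ROP) of the paper left-multiplies $A$ by a sequence of nonsingular $m\times m$ matrices $M_1,M_2,\dots$, with product $M=\cdots M_2M_1$, so that the rows of $A'=MA$ form a quasi-orthonormal list; the same operations applied to $b$ give $b'=Mb$. *)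

theory Defs
  imports "HOL-Analysis.Analysis"
begin

definition conj_closed_subfield :: "complex set \<Rightarrow> bool" where
  "conj_closed_subfield F \<longleftrightarrow>
     0 \<in> F \<and> 1 \<in> F \<and>
     (\<forall>x\<in>F. \<forall>y\<in>F. x + y \<in> F) \<and>
     (\<forall>x\<in>F. - x \<in> F) \<and>
     (\<forall>x\<in>F. \<forall>y\<in>F. x * y \<in> F) \<and>
     (\<forall>x\<in>F. x \<noteq> 0 \<longrightarrow> inverse x \<in> F) \<and>
     (\<forall>x\<in>F. cnj x \<in> F)"

definition vecs_over :: "complex set \<Rightarrow> (complex ^ 'k) set" where
  "vecs_over F = {v. \<forall>i. v $ i \<in> F}"

definition mats_over :: "complex set \<Rightarrow> (complex ^ 'n ^ 'm) set" where
  "mats_over F = {A. \<forall>i j. A $ i $ j \<in> F}"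

(* The library's inner product on complex ^ 'k is only its real part. *)
definition herm_inner :: "complex ^ 'k \<Rightarrow> complex ^ 'k \<Rightarrow> complex" where
  "herm_inner u v = (\<Sum>j\<in>UNIV. u $ j * cnj (v $ j))"

(* The library norm on complex ^ 'k is the Euclidean norm of this inner product. *)
lemma norm_eq_sqrt_herm_inner:
  "complex_of_real (norm u ^ 2) = herm_inner u u" "norm u = sqrt (Re (herm_inner u u))"
proof -
  show *: "complex_of_real (norm u ^ 2) = herm_inner u u"
    by (simp add: norm_vec_def L2_set_def sum_nonneg herm_inner_def complex_norm_square [symmetric])
  show "norm u = sqrt (Re (herm_inner u u))"
    unfolding * [symmetric] by simp
qed

definition conj_transpose :: "complex ^ 'n ^ 'm \<Rightarrow> complex ^ 'm ^ 'n" where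
  "conj_transpose A = (\<chi> i j. cnj (A $ j $ i))"

(* A list of vectors is an indexed family, so equal vectors at different
   positions count as distinct members. *)
definition quasi_orthonormal :: "('i \<Rightarrow> complex ^ 'k) \<Rightarrow> bool" where
  "quasi_orthonormal u \<longleftrightarrow>
     (\<forall>i. norm (u i) = 1 \<or> norm (u i) = 0) \<and>
     (\<forall>i j. i \<noteq> j \<and> norm (u i) = 1 \<and> norm (u j) = 1 \<longrightarrow> herm_inner (u i) (u j) = 0)"

definition min_norm_solution ::
    "complex set \<Rightarrow> complex ^ 'n ^ 'm \<Rightarrow> complex ^ 'm \<Rightarrow> complex ^ 'n \<Rightarrow> bool" where
  "min_norm_solution F A b x \<longleftrightarrow>
     x \<in> vecs_over F \<and> A *v x = b \<and>
     (\<forall>y\<in>vecs_over F. A *v y = b \<longrightarrow> norm x \<le> norm y)"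

end

(* Consistency gives b' = A' x for a solution x. The Gram matrix A' A'* is diagonal with entries
   0 and 1, the zeros occurring at the zero rows of A', so A' A'* A' = A' and x_p = A'* A' x is the
   orthogonal projection of any solution x onto the row space of A'; a projection does not
   increase the norm. *)
theory Submission
  imports Defs
begin

lemma conj_closed_subfield_sum:
  assumes "conj_closed_subfield F" and "\<And>i. i \<in> S \<Longrightarrow> f i \<in> F"
  shows "sum f S \<in> F"
  using assms(2)
  by (induction S rule: infinite_finite_induct)
    (use assms(1) in \<open>auto simp: conj_closed_subfield_def\<close>)

lemma matrix_vector_mult_vecs_over:
  assumes F: "conj_closed_subfield F" and "A \<in> mats_over F" "v \<in> vecs_over F"
  shows "A *v v \<in> vecs_over F"
  using assms
  by (auto simp: vecs_over_def mats_over_def matrix_vector_mult_def conj_closed_subfield_def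
      intro!: conj_closed_subfield_sum[OF F])

lemma matrix_matrix_mult_mats_over:
  assumes F: "conj_closed_subfield F" and "A \<in> mats_over F" "B \<in> mats_over F"
  shows "A ** B \<in> mats_over F"
  using assms
  by (auto simp: mats_over_def matrix_matrix_mult_def conj_closed_subfield_def
      intro!: conj_closed_subfield_sum[OF F])

lemma conj_transpose_mats_over:
  assumes "conj_closed_subfield F" and "A \<in> mats_over F"
  shows "conj_transpose A \<in> mats_over F"
  using assms by (auto simp: mats_over_def conj_transpose_def conj_closed_subfield_def)

text \<open>Bridge to the real inner product: only norms are compared later, so real parts suffice
  and the real Cauchy-Schwarz inequality applies.\<close>

lemma inner_complex_vec_eq_Re_herm_inner: "x \<bullet> y = Re (herm_inner x y)"
  by (simp add: inner_vec_def herm_inner_def inner_complex_def)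

lemma herm_inner_conj_transpose:
  "herm_inner x (conj_transpose A *v v) = herm_inner (A *v x) v"
proof -
  have "herm_inner x (conj_transpose A *v v)
      = (\<Sum>j\<in>UNIV. \<Sum>i\<in>UNIV. A $ i $ j * x $ j * cnj (v $ i))"
    by (simp add: herm_inner_def matrix_vector_mult_def conj_transpose_def sum_distrib_left
        mult_ac)
  also have "\<dots> = (\<Sum>i\<in>UNIV. \<Sum>j\<in>UNIV. A $ i $ j * x $ j * cnj (v $ i))"
    by (rule sum.swap)
  also have "\<dots> = herm_inner (A *v x) v"
    by (simp add: herm_inner_def matrix_vector_mult_def sum_distrib_right)
  finally show ?thesis .
qed

lemma inner_conj_transpose: "x \<bullet> (conj_transpose A *v v) = (A *v x) \<bullet> v"
  by (simp add: inner_complex_vec_eq_Re_herm_inner herm_inner_conj_transpose)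

lemma mult_conj_transpose_component:
  "(A ** conj_transpose A) $ i $ j = herm_inner (row i A) (row j A)"
  by (simp add: matrix_matrix_mult_def conj_transpose_def herm_inner_def row_def)

text \<open>A member of norm 0 is the zero vector and pairs to 0 with everything; all other members
  are unit vectors, orthogonal at distinct positions.\<close>

lemma quasi_orthonormal_herm_inner:
  assumes "quasi_orthonormal u"
  shows "herm_inner (u i) (u j) = (if i = j \<and> u i \<noteq> 0 then 1 else 0)"
proof (cases "u i = 0 \<or> u j = 0")
  case True
  then show ?thesis by (auto simp: herm_inner_def)
next
  case False
  then have "norm (u i) = 1" "norm (u j) = 1"
    using assms by (auto simp: quasi_orthonormal_def)
  then show ?thesis
    using False assms norm_eq_sqrt_herm_inner(1)[of "u i"]
    by (auto simp: quasi_orthonormal_def)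
qed

lemma quasi_orthonormal_rows_projection:
  assumes "quasi_orthonormal (\<lambda>i. row i A)"
  shows "A *v (conj_transpose A *v (A *v x)) = A *v x"
proof -
  have gram: "((A ** conj_transpose A) *v y) $ i = (if row i A = 0 then 0 else y $ i)" for y i
  proof -
    have "((A ** conj_transpose A) *v y) $ i
        = (\<Sum>j\<in>UNIV. if j = i then (if row i A = 0 then 0 else y $ i) else 0)"
      unfolding matrix_vector_mult_def vec_lambda_beta
      by (rule sum.cong)
        (auto simp: mult_conj_transpose_component quasi_orthonormal_herm_inner[OF assms])
    then show ?thesis
      by simp
  qed
  \<comment> \<open>The Gram matrix erases exactly the coordinates at zero rows, and there
    \<open>A *v x\<close> vanishes already.\<close>
  have "(A *v x) $ i = 0" if "row i A = 0" for i
    using that by (auto simp: row_def vec_eq_iff matrix_vector_mult_def)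
  then have "(A ** conj_transpose A) *v (A *v x) = A *v x"
    unfolding vec_eq_iff gram by simp
  then show ?thesis
    by (simp only: matrix_vector_mul_assoc matrix_mul_assoc)
qed

lemma quasi_orthonormal_rows_projection_norm_le:
  assumes "quasi_orthonormal (\<lambda>i. row i A)"
  shows "norm (conj_transpose A *v (A *v x)) \<le> norm x"
proof -
  let ?p = "conj_transpose A *v (A *v x)"
  \<comment> \<open>Moving \<open>conj_transpose A\<close> across turns both sides into
    \<open>(A *v x) \<bullet> (A *v x)\<close>; on the left this uses
    \<open>A *v ?p = A *v x\<close>.\<close>
  have "?p \<bullet> ?p = x \<bullet> ?p"
    by (simp add: inner_conj_transpose quasi_orthonormal_rows_projection[OF assms])
  then have "norm ?p * norm ?p \<le> norm x * norm ?p"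
    using norm_cauchy_schwarz[of x ?p] by (simp add: dot_square_norm power2_eq_square)
  then show ?thesis
    \<comment> \<open>Cancel the common factor \<open>norm ?p\<close> unless it is zero, when the
      bound is trivial.\<close>
    by (cases "norm ?p = 0") auto
qed

theorem mainTheorem3:
  fixes F :: "complex set"
    and A A' :: "complex ^ 'n ^ 'm"
    and M :: "complex ^ 'm ^ 'm"
    and b b' :: "complex ^ 'm"
  assumes "conj_closed_subfield F"
    and "A \<in> mats_over F" and "b \<in> vecs_over F"
    and "\<exists>x\<in>vecs_over F. A *v x = b"
    and "M \<in> mats_over F" and "invertible M"
    and "A' = M ** A" and "quasi_orthonormal (\<lambda>i. row i A')"
    and "b' = M *v b"
  shows "min_norm_solution F A b (conj_transpose A' *v b')"
proof -
  let ?p = "conj_transpose A' *v b'"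
  obtain N where N: "N ** M = mat 1"
    using \<open>invertible M\<close> by (auto simp: invertible_def)
  have A': "A' *v x = b'" if "A *v x = b" for x
    using that by (simp add: assms(7,9) flip: matrix_vector_mul_assoc)
  obtain x where "A *v x = b"
    using assms(4) by blast
  then have "A' *v ?p = b'"
    using A' quasi_orthonormal_rows_projection[OF assms(8)] by metis
  \<comment> \<open>So far \<open>?p\<close> solves only the transformed system; the left inverse
    \<open>N\<close> of \<open>M\<close> carries this back to the original one.\<close>
  then have "N *v (M *v (A *v ?p)) = N *v (M *v b)"
    unfolding assms(7,9) by (simp flip: matrix_vector_mul_assoc)
  then have "A *v ?p = b"
    by (simp only: matrix_vector_mul_assoc[of N M] N matrix_vector_mul_lid)
  \<comment> \<open>Closure of \<open>F\<close> under conjugation keeps the entries of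
    \<open>conj_transpose A'\<close> in \<open>F\<close>.\<close>
  moreover have "?p \<in> vecs_over F"
    using assms by (simp add: matrix_vector_mult_vecs_over conj_transpose_mats_over
        matrix_matrix_mult_mats_over)
  \<comment> \<open>Since \<open>b' = A' *v y\<close>, the same \<open>?p\<close> is the projection
    of every solution \<open>y\<close>.\<close>
  moreover have "norm ?p \<le> norm y" if "A *v y = b" for y
    using quasi_orthonormal_rows_projection_norm_le[OF assms(8), of y] A'[OF that] by simp
  ultimately show ?thesis
    by (simp add: min_norm_solution_def)
qed

end
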